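(* Let $M=(E,\mathcal I)$ be a matroid, let $w:E\to\mathbb R$ be a weight function, let $E_0\subset E$ be a subset that contains a basis of $M$, and let $T=|E\setminus E_0|$. Then the simplified greedy algorithm described in the context finds an optimal solution for the problem IMD-MWB, i.e., for the incremental matroid design problem with minimum weight bases $$\min\left\{\sum_{i=0}^T f(A_i)\ :\ A_0=\emptyset,\ |A_i\setminus A_{i-1}|=1\text{ for }i=1,\ldots,T\right\}.$$
   Context: For a set $A$ and an element $e$ write $A+e=A\cup\{e\}$ and $A-e=A\setminus\{e\}$. The weight function is extended to subsets $X\subseteq E$ by $w(X)=\sum_{e\in X}w(e)$. For $A\subseteq E\setminus E_0$ let $$f(A)=\min\{w(X)\ :\ X\subseteq E_0\cup A\text{ is a basis of }M\}.$$ The incremental matroid design problem with minimum weight bases (IMD-MWB) for the time horizon $T=|E\setminus E_0|$ is the minimization problem displayed in the claim, where the $A_i$ are subsets of $E\setminus E_0$. For a basis $X$ of $M$, a pair $(e,e')\in X\times(E\setminus X)$ is called an exchange pair for $X$ if $X-e+e'$ is another basis. For $Y\subseteq E$, an exchange pair for $(X,Y)$ is an exchange pair $(e,e')$ for $X$ whose second component $e'$ belongs to $Y\setminus X$; it is called optimal if $w(e)-w(e')$ is maximum among the exchange pairs for $(X,Y)$. Simplified greedy algorithm: Let $X$ be any minimum weight basis of the submatroid induced by $E_0$, and let $Y$ be any minimum weight basis of the matroid $M$ (kept fixed throughout). For $k=1,\ldots,|Y\setminus X|$ do: let $(e,e')$ be an optimal exchange pair for $(X,Y)$; set $X\leftarrow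 X-e+e'$; set $e'_k\leftarrow e'$. Return $(e'_1,\ldots,e'_k)$. The output $(e'_1,\ldots,e'_k)$ of the greedy strategy defines the sets $A_i$ via $A_0=\emptyset$, $A_i=\{e'_1,\ldots,e'_i\}$ for $i\leqslant k$, and $A_i=A_{i-1}+e'$ for arbitrary $e'\in E\setminus(E_0\cup A_{i-1})$ for $k+1\leqslant i\leqslant T$.
   Formalization: With tied weights the greedy output may contain an element of E_0 or repeat an element, so the A_i as defined can be infeasible; in the formal version such an e'_i is replaced by an arbitrary new element of E \ (E_0 ∪ A_{i-1}), as is done for i > k. *)

theory Defs
  imports Complex_Main
begin

locale matroid =
  fixes E :: "'a set" and \<I> :: "'a set set"
  assumes finite_ground: "finite E"
    and indep_subset_ground: "X \<in> \<I> \<Longrightarrow> X \<subseteq> E"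
    and empty_indep: "{} \<in> \<I>"
    and indep_subset: "X \<in> \<I> \<Longrightarrow> Z \<subseteq> X \<Longrightarrow> Z \<in> \<I>"
    and augmentation:
      "X \<in> \<I> \<Longrightarrow> Z \<in> \<I> \<Longrightarrow> card X < card Z \<Longrightarrow> \<exists>e\<in>Z - X. insert e X \<in> \<I>"

definition basis :: "'a set set \<Rightarrow> 'a set \<Rightarrow> bool" where
  "basis \<I> X \<longleftrightarrow> X \<in> \<I> \<and> (\<forall>Z\<in>\<I>. X \<subseteq> Z \<longrightarrow> Z = X)"

definition restriction :: "'a set set \<Rightarrow> 'a set \<Rightarrow> 'a set set" where
  "restriction \<I> S = {X \<in> \<I>. X \<subseteq> S}"

definition min_weight_basis :: "'a set set \<Rightarrow> ('a \<Rightarrow> real) \<Rightarrow> 'a set \<Rightarrow> bool" where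
  "min_weight_basis \<I> w X \<longleftrightarrow> is_arg_min (sum w) (basis \<I>) X"

definition mwb_value :: "'a set set \<Rightarrow> ('a \<Rightarrow> real) \<Rightarrow> 'a set \<Rightarrow> 'a set \<Rightarrow> real" where
  "mwb_value \<I> w E\<^sub>0 A = Min (sum w ` {X. basis \<I> X \<and> X \<subseteq> E\<^sub>0 \<union> A})"

text \<open>
  A solution is a family indexed by \<open>0, \<dots>, T\<close>, where \<open>T = card (E - E\<^sub>0)\<close>; values beyond \<open>T\<close>
  are irrelevant. As in the displayed minimization problem, the sets are not required to be
  nested: only \<open>card (A i - A (i - 1)) = 1\<close> is demanded.
\<close>

definition imd_feasible :: "'a set \<Rightarrow> 'a set \<Rightarrow> (nat \<Rightarrow> 'a set) \<Rightarrow> bool" where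
  "imd_feasible E E\<^sub>0 A \<longleftrightarrow>
     A 0 = {} \<and>
     (\<forall>i\<in>{1..card (E - E\<^sub>0)}. A i \<subseteq> E - E\<^sub>0 \<and> card (A i - A (i - 1)) = 1)"

definition imd_objective ::
  "'a set \<Rightarrow> 'a set set \<Rightarrow> ('a \<Rightarrow> real) \<Rightarrow> 'a set \<Rightarrow> (nat \<Rightarrow> 'a set) \<Rightarrow> real" where
  "imd_objective E \<I> w E\<^sub>0 A = (\<Sum>i = 0..card (E - E\<^sub>0). mwb_value \<I> w E\<^sub>0 (A i))"

definition imd_optimal ::
  "'a set \<Rightarrow> 'a set set \<Rightarrow> ('a \<Rightarrow> real) \<Rightarrow> 'a set \<Rightarrow> (nat \<Rightarrow> 'a set) \<Rightarrow> bool" where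
  "imd_optimal E \<I> w E\<^sub>0 A \<longleftrightarrow> is_arg_min (imd_objective E \<I> w E\<^sub>0) (imd_feasible E E\<^sub>0) A"

definition exchange_pair :: "'a set set \<Rightarrow> 'a set \<Rightarrow> 'a set \<Rightarrow> 'a \<times> 'a \<Rightarrow> bool" where
  "exchange_pair \<I> X Y = (\<lambda>(e, e'). e \<in> X \<and> e' \<in> Y - X \<and> basis \<I> (insert e' (X - {e})))"

definition optimal_exchange_pair ::
  "'a set set \<Rightarrow> ('a \<Rightarrow> real) \<Rightarrow> 'a set \<Rightarrow> 'a set \<Rightarrow> 'a \<times> 'a \<Rightarrow> bool" where
  "optimal_exchange_pair \<I> w X Y p \<longleftrightarrow>
     is_arg_max (\<lambda>(e, e'). w e - w e') (exchange_pair \<I> X Y) p"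

definition greedy_start ::
  "'a set set \<Rightarrow> ('a \<Rightarrow> real) \<Rightarrow> 'a set \<Rightarrow> 'a set \<Rightarrow> 'a set \<Rightarrow> bool" where
  "greedy_start \<I> w E\<^sub>0 X\<^sub>0 Y \<longleftrightarrow>
     min_weight_basis (restriction \<I> E\<^sub>0) w X\<^sub>0 \<and> min_weight_basis \<I> w Y"

text \<open>
  \<open>greedy_run \<I> w Y X\<^sub>0 es X\<close>: starting from \<open>X\<^sub>0\<close>, some sequence of choices of optimal exchange
  pairs inserts the elements \<open>es\<close> in this order and ends with the current basis \<open>X\<close>. The run is
  complete when \<open>length es = card (Y - X\<^sub>0)\<close>.
\<close>

inductive greedy_run ::
  "'a set set \<Rightarrow> ('a \<Rightarrow> real) \<Rightarrow> 'a set \<Rightarrow> 'a set \<Rightarrow> 'a list \<Rightarrow> 'a set \<Rightarrow> bool"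
  for \<I> w Y X\<^sub>0 where
  init: "greedy_run \<I> w Y X\<^sub>0 [] X\<^sub>0"
| exchange: "greedy_run \<I> w Y X\<^sub>0 es X \<Longrightarrow> optimal_exchange_pair \<I> w X Y (e, e') \<Longrightarrow>
    greedy_run \<I> w Y X\<^sub>0 (es @ [e']) (insert e' (X - {e}))"

text \<open>
  The sets \<open>A\<^sub>0, \<dots>, A\<^sub>T\<close> obtained from the output \<open>es\<close>. With ties in the weights, a run may
  insert an element of \<open>E\<^sub>0\<close>, or drop an element and insert it again later (all weights equal,
  uniform matroid of rank 3 on six elements, \<open>E\<^sub>0\<close> and \<open>Y\<close> disjoint of size 3: the output can be
  \<open>[y\<^sub>1, y\<^sub>2, y\<^sub>1]\<close>). Such an output element cannot serve as the \<open>i\<close>-th increment of a feasible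
  solution, so an arbitrary new element is used for this index, as for the indices beyond
  \<open>length es\<close>. If the output consists of distinct elements of \<open>E - E\<^sub>0\<close>, then
  \<open>A\<^sub>i = {e'\<^sub>1, \<dots>, e'\<^sub>i}\<close>; see \<open>output_sets_eq_set_take\<close> below.
\<close>

definition output_sets :: "'a set \<Rightarrow> 'a set \<Rightarrow> 'a list \<Rightarrow> (nat \<Rightarrow> 'a set) \<Rightarrow> bool" where
  "output_sets E E\<^sub>0 es A \<longleftrightarrow>
     A 0 = {} \<and>
     (\<forall>i\<in>{1..card (E - E\<^sub>0)}.
        if i \<le> length es \<and> es ! (i - 1) \<notin> E\<^sub>0 \<union> A (i - 1)
        then A i = insert (es ! (i - 1)) (A (i - 1))
        else \<exists>e\<in>E - (E\<^sub>0 \<union> A (i - 1)). A i = insert e (A (i - 1)))"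

lemma output_sets_eq_set_take:
  assumes "finite E" "output_sets E E\<^sub>0 es A" "distinct es" "set es \<subseteq> E - E\<^sub>0" "i \<le> length es"
  shows "A i = set (take i es)"
  using assms(5)
proof (induction i)
  case 0
  then show ?case using assms(2) by (simp add: output_sets_def)
next
  case (Suc i)
  then have IH: "A i = set (take i es)" and i: "i < length es" by auto
  have "length es \<le> card (E - E\<^sub>0)"
    using assms card_mono[of "E - E\<^sub>0" "set es"] by (simp add: distinct_card)
  with i have "Suc i \<in> {1..card (E - E\<^sub>0)}" by auto
  moreover have "es ! i \<notin> set (take i es)"
    using i \<open>distinct es\<close> by (auto simp: in_set_conv_nth nth_eq_iff_index_eq)
  moreover have "es ! i \<notin> E\<^sub>0" using i assms(4) nth_mem by blast
  ultimately have "A (Suc i) = insert (es ! i) (A i)"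
    using assms(2) i IH unfolding output_sets_def by (metis Suc_leI UnE diff_Suc_1)
  then show ?case using IH i by (simp add: take_Suc_conv_app_nth)
qed

end

theory Submission
  imports Defs
begin

text \<open>
  Penalise every element outside \<open>E\<^sub>0\<close> by \<open>\<lambda> \<ge> 0\<close>. A basis \<open>X\<close> that is minimal for the penalised
  weight has minimum weight among the bases with at most \<open>card (X - E\<^sub>0)\<close> elements outside \<open>E\<^sub>0\<close>, and
  no feasible solution can use more than \<open>i\<close> new elements at index \<open>i\<close>. A minimum weight basis of
  \<open>E\<^sub>0\<close> is penalised-minimal for large \<open>\<lambda>\<close>. If \<open>X\<close> is penalised-minimal for \<open>\<lambda>\<close>, and the optimal
  exchange pair \<open>(e, e')\<close> has gain \<open>\<mu> > 0\<close>, then \<open>\<mu> \<le> \<lambda>\<close>, \<open>e \<in> E\<^sub>0\<close>, \<open>e' \<notin> E\<^sub>0\<close>, and both \<open>X\<close> and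
  \<open>X - e + e'\<close> are penalised-minimal for \<open>\<mu>\<close>. Restricting the entering elements to \<open>Y\<close> costs nothing,
  because strong basis exchange replaces an entering element by a no heavier one of \<open>Y\<close>. Once no gain
  is positive, \<open>X\<close> is a minimum weight basis of the whole matroid and remains one.
\<close>

section \<open>Penalised weights\<close>

definition penalised :: "('a \<Rightarrow> real) \<Rightarrow> 'a set \<Rightarrow> real \<Rightarrow> 'a \<Rightarrow> real" where
  "penalised w S c e = w e + (if e \<in> S then 0 else c)"

text \<open>Exhibits \<open>penalised\<close> as the Lagrangian relaxation, with multiplier
  \<open>c\<close>, of a bound on the number of elements outside \<open>S\<close>.\<close>

lemma sum_penalised:
  assumes "finite X"
  shows "sum (penalised w S c) X = sum w X + c * real (card (X - S))"
proof -
  have "(\<Sum>e\<in>X. if e \<in> S then 0 else c) = (\<Sum>e\<in>X - S. c)"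
    by (rule sum.mono_neutral_cong_right) (use assms in auto)
  then show ?thesis by (simp add: penalised_def sum.distrib mult.commute)
qed

lemma min_weight_basis_iff:
  "min_weight_basis \<I> w X \<longleftrightarrow> basis \<I> X \<and> (\<forall>Z. basis \<I> Z \<longrightarrow> sum w X \<le> sum w Z)"
  by (auto simp: min_weight_basis_def is_arg_min_linorder)

lemma card_swap:
  assumes "finite X" "a \<in> X" "b \<notin> X"
  shows "card (insert b (X - {a})) = card X"
  using assms by (metis DiffD1 card_Suc_Diff1 card_insert_disjoint finite_Diff)

context matroid
begin

section \<open>Independent sets and bases\<close>

lemma indep_finite: "X \<in> \<I> \<Longrightarrow> finite X"
  using indep_subset_ground finite_ground finite_subset by blast

text \<open>Repeated augmentation from \<open>Q\<close>. The bound on \<open>J\<close> is what later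
  locates the elements found by exchange arguments.\<close>

lemma extend_indep:
  assumes "P \<in> \<I>" "Q \<in> \<I>" "card P \<le> card Q"
  shows "\<exists>J\<in>\<I>. P \<subseteq> J \<and> J \<subseteq> P \<union> Q \<and> card J = card Q"
  using assms
proof (induction "card Q - card P" arbitrary: P)
  case 0
  then show ?case by auto
next
  case (Suc n)
  then have "card P < card Q" by simp
  with augmentation[OF Suc.prems(1,2)] obtain e where e: "e \<in> Q - P" "insert e P \<in> \<I>" by blast
  with Suc indep_finite[of P] have "n = card Q - card (insert e P)" "card (insert e P) \<le> card Q" by auto
  from Suc.hyps(1)[OF this(1) e(2) Suc.prems(2) this(2)] obtain J where
    "J\<in>\<I>" "insert e P \<subseteq> J" "J \<subseteq> insert e P \<union> Q" "card J = card Q" by auto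
  with e show ?case by (intro bexI[of _ J]) auto
qed

lemma basis_indep: "basis \<I> X \<Longrightarrow> X \<in> \<I>"
  by (simp add: basis_def)

lemma basis_subset_ground: "basis \<I> X \<Longrightarrow> X \<subseteq> E"
  using basis_indep indep_subset_ground by blast

lemma basis_finite: "basis \<I> X \<Longrightarrow> finite X"
  using basis_indep indep_finite by blast

lemma card_indep_le_basis:
  assumes "basis \<I> X" "Z \<in> \<I>"
  shows "card Z \<le> card X"
proof (rule ccontr)
  assume "\<not> ?thesis"
  then obtain e where "e \<in> Z - X" "insert e X \<in> \<I>"
    using augmentation[of X Z] assms basis_indep by auto
  then show False using assms(1) by (auto simp: basis_def)
qed

lemma basis_cardI:
  assumes "basis \<I> X" "Z \<in> \<I>" "card X \<le> card Z"
  shows "basis \<I> Z"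
  unfolding basis_def
proof (intro conjI ballI impI)
  fix W assume "W \<in> \<I>" "Z \<subseteq> W"
  moreover have "card W \<le> card Z"
    using card_indep_le_basis[OF assms(1) \<open>W \<in> \<I>\<close>] assms(3) by simp
  ultimately show "W = Z" using card_seteq indep_finite by metis
qed fact

section \<open>Strong exchange and local optimality\<close>

lemma finite_bases: "finite {X. basis \<I> X}"
  by (rule finite_subset[of _ "Pow E"]) (use basis_subset_ground finite_ground in auto)

lemma basis_swapI:
  assumes "basis \<I> X" "a \<in> X" "b \<notin> X" "insert b (X - {a}) \<in> \<I>"
  shows "basis \<I> (insert b (X - {a}))"
proof (rule basis_cardI[OF assms(1,4)])
  show "card X \<le> card (insert b (X - {a}))"
    using card_swap[of X a b] assms basis_finite[OF assms(1)] by simp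
qed

text \<open>Removing \<open>x\<close> from its fundamental circuit in \<open>B2\<close> leaves
  \<open>D\<close>. Extend \<open>D\<close> by elements of \<open>B1\<close> to a set as large as
  \<open>B1\<close>; it avoids \<open>x\<close>, because \<open>D\<close> and \<open>x\<close>
  together are dependent. Augmenting \<open>B1 - {x}\<close> from that set must then pick an element
  of \<open>D - B1\<close>.\<close>

lemma strong_basis_exchange:
  assumes B1: "basis \<I> B1" and B2: "basis \<I> B2" and x: "x \<in> B1 - B2"
  obtains y where "y \<in> B2 - B1" "basis \<I> (insert y (B1 - {x}))" "basis \<I> (insert x (B2 - {y}))"
proof -
  have fin: "finite B1" "finite B2" using B1 B2 basis_finite by auto
  \<comment> \<open>\<open>insert x D\<close> is the fundamental circuit of \<open>x\<close> with respect to \<open>B2\<close>\<close>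
  define D where "D = {y \<in> B2. insert x (B2 - {y}) \<in> \<I>}"
  have D: "D \<in> \<I>" using indep_subset[OF basis_indep[OF B2]] by (auto simp: D_def)
  have dep: "insert x D \<notin> \<I>"
  proof
    \<comment> \<open>An extension \<open>J\<close> of size \<open>card B2\<close> inside
      \<open>insert x B2\<close> misses exactly one \<open>y\<close> of \<open>B2\<close>. That
      \<open>y\<close> lies in \<open>D\<close> by definition, hence in \<open>J\<close>, a
      contradiction.\<close>
    assume "insert x D \<in> \<I>"
    from extend_indep[OF this basis_indep[OF B2] card_indep_le_basis[OF B2 this]]
    obtain J where J: "J \<in> \<I>" "insert x D \<subseteq> J" "J \<subseteq> insert x B2" "card J = card B2"
      unfolding D_def by blast
    have "\<not> B2 \<subseteq> J"
    proof
      assume "B2 \<subseteq> J"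
      with J have "J = insert x B2" by auto
      with J(4) x fin show False by simp
    qed
    then obtain y where y: "y \<in> B2" "y \<notin> J" by auto
    have "J \<subseteq> insert x (B2 - {y})" using J y by auto
    moreover have "card (insert x (B2 - {y})) = card J"
      using card_swap[of B2 y x] fin x y J by simp
    ultimately have "J = insert x (B2 - {y})" using fin by (simp add: card_subset_eq)
    with J y show False by (auto simp: D_def)
  qed
  have "\<exists>y\<in>D - B1. insert y (B1 - {x}) \<in> \<I>"
  proof -
    have "card D \<le> card B1" using card_indep_le_basis[OF B1 D] .
    from extend_indep[OF D basis_indep[OF B1] this]
    obtain J where J: "J \<in> \<I>" "D \<subseteq> J" "J \<subseteq> D \<union> B1" "card J = card B1" by blast
    have xJ: "x \<notin> J" using J dep indep_subset by (metis insert_subset)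
    have "card (B1 - {x}) < card J" using J x fin card_Diff1_less[of B1 x] by simp
    moreover have "B1 - {x} \<in> \<I>" using indep_subset[OF basis_indep[OF B1]] by auto
    ultimately obtain y where "y \<in> J - (B1 - {x})" "insert y (B1 - {x}) \<in> \<I>"
      using augmentation[of "B1 - {x}" J] J by blast
    with J xJ show ?thesis by blast
  qed
  then obtain y where y: "y \<in> D - B1" "insert y (B1 - {x}) \<in> \<I>" by blast
  then have "basis \<I> (insert y (B1 - {x}))" "basis \<I> (insert x (B2 - {y}))"
    using basis_swapI[OF B1] basis_swapI[OF B2] x by (auto simp: D_def)
  with y that show thesis by (auto simp: D_def)
qed

text \<open>Move \<open>Z\<close> towards \<open>X\<close>: strong exchange trades some
  \<open>z\<close> of \<open>Z - X\<close> for an \<open>x\<close> of \<open>X - Z\<close> without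
  raising the weight, as \<open>(x, z)\<close> is one of the tested pairs. Since \<open>x\<close>
  lies in \<open>X\<close>, the new basis has no entering elements beyond those of \<open>Z\<close>,
  so the hypothesis survives.\<close>

lemma sum_basis_le:
  fixes v :: "'a \<Rightarrow> real"
  assumes "basis \<I> X" "basis \<I> Z"
    and "\<And>a b. exchange_pair \<I> X Z (a, b) \<Longrightarrow> v a \<le> v b"
  shows "sum v X \<le> sum v Z"
  using assms(2,3)
proof (induction "card (Z - X)" arbitrary: Z rule: less_induct)
  case less
  show ?case
  proof (cases "Z \<subseteq> X")
    case True
    then have "Z = X" using assms(1) less.prems(1) by (auto simp: basis_def)
    then show ?thesis by simp
  next
    case False
    then obtain z where z: "z \<in> Z - X" by auto
    from strong_basis_exchange[OF less.prems(1) assms(1) z]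
    obtain x where x: "x \<in> X - Z" "basis \<I> (insert x (Z - {z}))" "basis \<I> (insert z (X - {x}))" .
    have "v x \<le> v z" using less.prems(2)[of x z] x z by (simp add: exchange_pair_def)
    moreover have "sum v X \<le> sum v (insert x (Z - {z}))"
    proof (rule less.hyps[OF _ x(2)])
      show "card (insert x (Z - {z}) - X) < card (Z - X)"
        by (rule psubset_card_mono) (use x z basis_finite[OF less.prems(1)] in auto)
      show "v a \<le> v b" if "exchange_pair \<I> X (insert x (Z - {z})) (a, b)" for a b
        using that less.prems(2)[of a b] x by (auto simp: exchange_pair_def)
    qed
    ultimately show ?thesis
      using x z basis_finite[OF less.prems(1)] by (simp add: sum_diff1)
  qed
qed

text \<open>The direction from local to global is \<open>sum_basis_le\<close>. The weight
  \<open>v\<close> is arbitrary so that the criterion applies to \<open>w\<close> and to its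
  penalised versions alike.\<close>

lemma min_weight_basis_iff_local:
  "min_weight_basis \<I> v X \<longleftrightarrow>
    basis \<I> X \<and> (\<forall>a b. exchange_pair \<I> X E (a, b) \<longrightarrow> v a \<le> v b)" (is "?L \<longleftrightarrow> ?R")
proof
  assume L: ?L
  show ?R
  proof (intro conjI allI impI)
    show "basis \<I> X" using L by (simp add: min_weight_basis_iff)
    fix a b assume p: "exchange_pair \<I> X E (a, b)"
    then have "sum v X \<le> sum v (insert b (X - {a}))"
      using L by (auto simp: min_weight_basis_iff exchange_pair_def)
    then show "v a \<le> v b"
      using p \<open>basis \<I> X\<close> basis_finite[of X] by (simp add: exchange_pair_def sum_diff1)
  qed
next
  assume R: ?R
  show ?L unfolding min_weight_basis_iff
  proof (intro conjI allI impI)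
    show "basis \<I> X" using R by simp
    fix Z assume Z: "basis \<I> Z"
    show "sum v X \<le> sum v Z"
      by (rule sum_basis_le) (use R Z basis_subset_ground[OF Z] in \<open>auto simp: exchange_pair_def\<close>)
  qed
qed

section \<open>Exchange pairs\<close>

lemma exchange_pairD:
  assumes "exchange_pair \<I> X Y (e, e')"
  shows "e \<in> X" "e' \<in> Y" "e' \<notin> X" "basis \<I> (insert e' (X - {e}))"
  using assms by (auto simp: exchange_pair_def)

lemma exchange_pair_exists:
  assumes "basis \<I> X" "basis \<I> Y" "e' \<in> Y - X"
  obtains e where "exchange_pair \<I> X Y (e, e')"
  using strong_basis_exchange[OF assms(2,1,3)] assms(3) by (auto simp: exchange_pair_def)

lemma optimal_exchange_pair_iff:
  "optimal_exchange_pair \<I> w X Y (e, e') \<longleftrightarrow> exchange_pair \<I> X Y (e, e') \<and>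
    (\<forall>a b. exchange_pair \<I> X Y (a, b) \<longrightarrow> w a - w b \<le> w e - w e')"
  by (auto simp: optimal_exchange_pair_def is_arg_max_linorder)

lemma optimal_exchange_pair_exists:
  assumes "basis \<I> X" "basis \<I> Y" "Y \<noteq> X"
  obtains e e' where "optimal_exchange_pair \<I> w X Y (e, e')"
proof -
  let ?P = "{p. exchange_pair \<I> X Y p}"
  have "?P \<subseteq> X \<times> Y" by (auto simp: exchange_pair_def)
  then have fin: "finite ?P" using assms basis_finite by (meson finite_SigmaI finite_subset)
  have "\<not> Y \<subseteq> X" using assms by (auto simp: basis_def)
  then obtain y where "y \<in> Y - X" by auto
  then have "?P \<noteq> {}" using exchange_pair_exists[OF assms(1,2)] by blast
  \<comment> \<open>The gain is negated, which turns the maximum into a minimum over a finite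
    nonempty set.\<close>
  then obtain p where "is_arg_min (\<lambda>(e, e'). w e' - w e) (\<lambda>q. q \<in> ?P) p"
    using ex_is_arg_min_if_finite[OF fin] by metis
  then show thesis using that
    by (cases p) (force simp: optimal_exchange_pair_iff is_arg_min_linorder)
qed

section \<open>Greedy runs and their outputs\<close>

lemma greedy_run_basis:
  assumes "greedy_run \<I> w Y X\<^sub>0 es X" "basis \<I> X\<^sub>0"
  shows "basis \<I> X"
  using assms
  by (induction rule: greedy_run.induct)
    (auto simp: optimal_exchange_pair_iff exchange_pair_def)

lemma greedy_run_set_subset:
  assumes "greedy_run \<I> w Y X\<^sub>0 es X"
  shows "set es \<subseteq> Y" "X \<subseteq> X\<^sub>0 \<union> set es"
  using assms
  by (induction rule: greedy_run.induct)
    (auto simp: optimal_exchange_pair_iff exchange_pair_def)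

text \<open>An exchange brings one element of \<open>Y\<close> into \<open>X\<close> but may expel
  another, hence only an inequality. It shows that \<open>Y - X\<close> is nonempty before
  \<open>card (Y - X\<^sub>0)\<close> exchanges are done.\<close>

lemma greedy_run_card_diff:
  assumes "greedy_run \<I> w Y X\<^sub>0 es X" "finite Y"
  shows "card (Y - X\<^sub>0) \<le> card (Y - X) + length es"
  using assms(1)
proof (induction rule: greedy_run.induct)
  case (exchange es X e e')
  have "Y - X \<subseteq> insert e' (Y - insert e' (X - {e}))" by auto
  then have "card (Y - X) \<le> card (insert e' (Y - insert e' (X - {e})))"
    by (intro card_mono) (use \<open>finite Y\<close> in auto)
  also have "\<dots> \<le> Suc (card (Y - insert e' (X - {e})))"
    by (rule card_insert_le_m1) (use \<open>finite Y\<close> in auto)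
  finally show ?case using exchange.IH by simp
qed simp

text \<open>Ties may let an optimal pair expel an element \<open>e\<close> of \<open>Y\<close>.
  Strong exchange between \<open>Y\<close> and the new basis then offers some \<open>x\<close>
  outside \<open>Y\<close> to leave instead of \<open>e\<close>; minimality of \<open>Y\<close>
  gives \<open>w e \<le> w x\<close>, so the gain does not drop.\<close>

lemma optimal_exchange_pair_leaving_outside:
  assumes X: "basis \<I> X" and Y: "min_weight_basis \<I> w Y" and "Y \<noteq> X"
  obtains e e' where "optimal_exchange_pair \<I> w X Y (e, e')" "e \<notin> Y"
proof -
  have Yb: "basis \<I> Y" using Y by (simp add: min_weight_basis_iff)
  from optimal_exchange_pair_exists[OF X Yb \<open>Y \<noteq> X\<close>]
  obtain e e' where opt: "optimal_exchange_pair \<I> w X Y (e, e')" .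
  show thesis
  proof (cases "e \<in> Y")
    case True
    let ?B = "insert e' (X - {e})"
    have p: "e \<in> X" "e' \<in> Y" "e' \<notin> X" "basis \<I> ?B"
      using opt exchange_pairD by (auto simp: optimal_exchange_pair_iff)
    then have "e \<in> Y - ?B" using True by auto
    from strong_basis_exchange[OF Yb p(4) this]
    obtain x where x: "x \<in> ?B - Y" "basis \<I> (insert x (Y - {e}))" "basis \<I> (insert e (?B - {x}))" .
    have "insert e (?B - {x}) = insert e' (X - {x})" using x p by auto
    with x p have px: "exchange_pair \<I> X Y (x, e')" by (auto simp: exchange_pair_def)
    have "exchange_pair \<I> Y E (e, x)"
      using x True p basis_subset_ground[OF X] by (auto simp: exchange_pair_def)
    then have "w e \<le> w x" using Y by (auto simp: min_weight_basis_iff_local)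
    then have "optimal_exchange_pair \<I> w X Y (x, e')"
      using opt px by (force simp: optimal_exchange_pair_iff)
    with x that show thesis by auto
  qed (use opt that in auto)
qed

text \<open>If only elements outside \<open>Y\<close> ever leave, \<open>X \<inter> Y\<close> grows
  by exactly the entering element, so nothing is inserted twice.\<close>

lemma clean_greedy_run_exists:
  assumes X0: "basis \<I> X\<^sub>0" and Y: "min_weight_basis \<I> w Y" and "n \<le> card (Y - X\<^sub>0)"
  shows "\<exists>es X. greedy_run \<I> w Y X\<^sub>0 es X \<and> length es = n \<and> distinct es \<and>
    set es \<subseteq> Y - X\<^sub>0 \<and> X \<inter> Y = (X\<^sub>0 \<inter> Y) \<union> set es"
  using assms(3)
proof (induction n)
  case 0
  have "greedy_run \<I> w Y X\<^sub>0 [] X\<^sub>0" by (rule greedy_run.init)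
  then show ?case by force
next
  case (Suc n)
  then obtain es X where run: "greedy_run \<I> w Y X\<^sub>0 es X" and es: "length es = n" "distinct es"
    "set es \<subseteq> Y - X\<^sub>0" and XY: "X \<inter> Y = (X\<^sub>0 \<inter> Y) \<union> set es" by auto
  have "Y \<noteq> X"
  proof
    assume "Y = X"
    then have "Y - X\<^sub>0 \<subseteq> set es" using XY by auto
    then have "card (Y - X\<^sub>0) \<le> length es" by (meson List.finite_set card_length card_mono le_trans)
    then show False using Suc.prems es by simp
  qed
  from optimal_exchange_pair_leaving_outside[OF greedy_run_basis[OF run X0] Y this]
  obtain e e' where opt: "optimal_exchange_pair \<I> w X Y (e, e')" and e: "e \<notin> Y" .
  have e': "e' \<in> Y - X" using opt exchange_pairD by (auto simp: optimal_exchange_pair_iff)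
  have "greedy_run \<I> w Y X\<^sub>0 (es @ [e']) (insert e' (X - {e}))"
    using run opt by (rule greedy_run.exchange)
  moreover have "length (es @ [e']) = Suc n" using es by simp
  moreover have "distinct (es @ [e'])" using es e' XY by auto
  moreover have "set (es @ [e']) \<subseteq> Y - X\<^sub>0" using es e' XY by auto
  moreover have "insert e' (X - {e}) \<inter> Y = (X\<^sub>0 \<inter> Y) \<union> set (es @ [e'])" using XY e e' by auto
  ultimately show ?case by blast
qed

section \<open>Minimum weight bases of the restriction\<close>

lemma min_weight_basis_exists:
  fixes w :: "'a \<Rightarrow> real"
  assumes "basis \<I> B" "B \<subseteq> S"
  obtains X where "basis \<I> X" "X \<subseteq> S" "\<And>Z. basis \<I> Z \<Longrightarrow> Z \<subseteq> S \<Longrightarrow> sum w X \<le> sum w Z"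
proof -
  let ?P = "{X. basis \<I> X \<and> X \<subseteq> S}"
  have "finite ?P" by (rule finite_subset[OF _ finite_bases]) auto
  moreover have "?P \<noteq> {}" using assms by auto
  ultimately obtain X where "is_arg_min (sum w) (\<lambda>X. X \<in> ?P) X"
    using ex_is_arg_min_if_finite by metis
  then show thesis using that by (auto simp: is_arg_min_linorder)
qed

text \<open>As \<open>S\<close> contains the basis \<open>B\<close>, a maximal independent subset of
  \<open>S\<close> extends within \<open>S\<close> to the size of \<open>B\<close> and so already
  has it.\<close>

lemma basis_restriction_iff:
  assumes "basis \<I> B" "B \<subseteq> S"
  shows "basis (restriction \<I> S) X \<longleftrightarrow> basis \<I> X \<and> X \<subseteq> S"
proof
  assume L: "basis (restriction \<I> S) X"
  then have X: "X \<in> \<I>" "X \<subseteq> S" by (auto simp: basis_def restriction_def)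
  from extend_indep[OF X(1) basis_indep[OF assms(1)] card_indep_le_basis[OF assms(1) X(1)]]
  obtain J where J: "J \<in> \<I>" "X \<subseteq> J" "J \<subseteq> X \<union> B" "card J = card B" by blast
  then have "J \<in> restriction \<I> S" using X assms by (auto simp: restriction_def)
  with J L have "J = X" by (auto simp: basis_def)
  then have "basis \<I> X" using J basis_cardI[OF assms(1)] by simp
  with X show "basis \<I> X \<and> X \<subseteq> S" by simp
qed (auto simp: basis_def restriction_def)

lemma min_weight_basis_restriction_iff:
  assumes "basis \<I> B" "B \<subseteq> S"
  shows "min_weight_basis (restriction \<I> S) w X \<longleftrightarrow>
    basis \<I> X \<and> X \<subseteq> S \<and> (\<forall>Z. basis \<I> Z \<longrightarrow> Z \<subseteq> S \<longrightarrow> sum w X \<le> sum w Z)"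
  by (auto simp: min_weight_basis_iff basis_restriction_iff[OF assms])

text \<open>Among the minimum weight bases of the restriction take one meeting \<open>Y\<close> in
  as many elements as possible. A missing \<open>y\<close> in \<open>Y \<inter> E\<^sub>0\<close>
  could replace some \<open>x\<close> outside \<open>Y\<close> with \<open>w y \<le> w x\<close>,
  giving a larger intersection. With such a start every element of \<open>Y - X\<^sub>0\<close> is
  new.\<close>

lemma compatible_greedy_start_exists:
  assumes B: "basis \<I> B" "B \<subseteq> E\<^sub>0"
  obtains X\<^sub>0 Y where "greedy_start \<I> w E\<^sub>0 X\<^sub>0 Y" "Y \<inter> E\<^sub>0 \<subseteq> X\<^sub>0"
proof -
  obtain Y where Y: "min_weight_basis \<I> w Y"
    using min_weight_basis_exists[OF B(1) subset_UNIV, of w] by (metis min_weight_basis_iff subset_UNIV)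
  then have Yb: "basis \<I> Y" by (simp add: min_weight_basis_iff)
  let ?R = "min_weight_basis (restriction \<I> E\<^sub>0) w"
  note R_iff = min_weight_basis_restriction_iff[OF B, of w]
  have "\<exists>X. ?R X" using min_weight_basis_exists[OF B, of w] R_iff by metis
  moreover have "\<forall>Z. ?R Z \<longrightarrow> card (Z \<inter> Y) < Suc (card Y)"
    using card_mono[OF basis_finite[OF Yb]] by (simp add: less_Suc_eq_le)
  ultimately obtain X where X: "?R X" "\<And>Z. ?R Z \<Longrightarrow> card (Z \<inter> Y) \<le> card (X \<inter> Y)"
    using ex_has_greatest_nat[of ?R _ "\<lambda>Z. card (Z \<inter> Y)" "Suc (card Y)"] by blast
  have Xb: "basis \<I> X" "X \<subseteq> E\<^sub>0" and Xmin: "\<And>Z. basis \<I> Z \<Longrightarrow> Z \<subseteq> E\<^sub>0 \<Longrightarrow> sum w X \<le> sum w Z"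
    using X(1) R_iff by auto
  have "Y \<inter> E\<^sub>0 \<subseteq> X"
  proof
    fix y assume y: "y \<in> Y \<inter> E\<^sub>0"
    show "y \<in> X"
    proof (rule ccontr)
      assume "y \<notin> X"
      with y have "y \<in> Y - X" by auto
      from strong_basis_exchange[OF Yb Xb(1) this]
      obtain x where x: "x \<in> X - Y" "basis \<I> (insert x (Y - {y}))" "basis \<I> (insert y (X - {x}))" .
      have "sum w Y \<le> sum w (insert x (Y - {y}))"
        using Y x(2) by (simp add: min_weight_basis_iff)
      then have "w y \<le> w x" using x y basis_finite[OF Yb] by (simp add: sum_diff1)
      then have "sum w (insert y (X - {x})) \<le> sum w X"
        using x \<open>y \<notin> X\<close> basis_finite[OF Xb(1)] by (simp add: sum_diff1)
      then have "?R (insert y (X - {x}))"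
        unfolding R_iff using x(3) y Xb Xmin by force
      from X(2)[OF this] have "card (insert y (X - {x}) \<inter> Y) \<le> card (X \<inter> Y)" .
      moreover have "insert y (X - {x}) \<inter> Y = insert y (X \<inter> Y)" using x y by auto
      ultimately show False using \<open>y \<notin> X\<close> basis_finite[OF Xb(1)] by simp
    qed
  qed
  with X(1) Y that show thesis by (auto simp: greedy_start_def)
qed

section \<open>Penalised minimality along a run\<close>

lemma min_weight_basis_penalised_start:
  assumes B: "basis \<I> B" "B \<subseteq> E\<^sub>0" and X: "min_weight_basis (restriction \<I> E\<^sub>0) w X"
  obtains c where "c \<ge> 0" "min_weight_basis \<I> (penalised w E\<^sub>0 c) X"
proof -
  have Xb: "basis \<I> X" "X \<subseteq> E\<^sub>0" and Xmin: "\<And>Z. basis \<I> Z \<Longrightarrow> Z \<subseteq> E\<^sub>0 \<Longrightarrow> sum w X \<le> sum w Z"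
    using X min_weight_basis_restriction_iff[OF B, of w] by auto
  \<comment> \<open>Half of \<open>c\<close> bounds every weight in absolute value, so the penalty
    outweighs any gain from swapping in an element outside \<open>E\<^sub>0\<close>.\<close>
  define c where "c = 2 * (\<Sum>e\<in>E. \<bar>w e\<bar>)"
  have bound: "\<bar>w e\<bar> \<le> c / 2" if "e \<in> E" for e
    using member_le_sum[of e E "\<lambda>e. \<bar>w e\<bar>"] that finite_ground by (simp add: c_def)
  have "c \<ge> 0" by (simp add: c_def sum_nonneg)
  moreover have "min_weight_basis \<I> (penalised w E\<^sub>0 c) X"
    unfolding min_weight_basis_iff_local
  proof (intro conjI allI impI)
    fix a b assume "exchange_pair \<I> X E (a, b)"
    then have ab: "a \<in> X" "b \<in> E" "b \<notin> X" "basis \<I> (insert b (X - {a}))"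
      by (auto simp: exchange_pair_def)
    then have a: "a \<in> E" "a \<in> E\<^sub>0" using Xb basis_subset_ground by auto
    show "penalised w E\<^sub>0 c a \<le> penalised w E\<^sub>0 c b"
    proof (cases "b \<in> E\<^sub>0")
      case True
      then have "sum w X \<le> sum w (insert b (X - {a}))" using Xmin ab Xb by auto
      then have "w a \<le> w b" using ab basis_finite[OF Xb(1)] by (simp add: sum_diff1)
      then show ?thesis using True a by (simp add: penalised_def)
    next
      case False
      then show ?thesis using bound[OF a(1)] bound[OF ab(2)] a by (simp add: penalised_def)
    qed
  qed (rule Xb)
  ultimately show thesis by (rule that)
qed

text \<open>The multiplier drops from \<open>c\<close> to the gain \<open>?m\<close>. A swap within
  \<open>E\<^sub>0\<close> or within its complement is unaffected by the multiplier, a swap back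
  into \<open>E\<^sub>0\<close> stays unprofitable for every multiplier up to \<open>c\<close>, and
  a swap out of \<open>E\<^sub>0\<close> is controlled by the optimality of the pair.\<close>

lemma penalised_exchange:
  assumes X: "min_weight_basis \<I> (penalised w E\<^sub>0 c) X" and "c \<ge> 0"
    and Y: "min_weight_basis \<I> w Y"
    and opt: "optimal_exchange_pair \<I> w X Y (e, e')" and pos: "w e - w e' > 0"
  shows "e \<in> E\<^sub>0" "e' \<notin> E\<^sub>0"
    "min_weight_basis \<I> (penalised w E\<^sub>0 (w e - w e')) (insert e' (X - {e}))"
proof -
  let ?m = "w e - w e'"
  have Yb: "basis \<I> Y" and Xb: "basis \<I> X" using X Y by (auto simp: min_weight_basis_iff)
  have Xloc: "penalised w E\<^sub>0 c a \<le> penalised w E\<^sub>0 c b" if "exchange_pair \<I> X E (a, b)" for a b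
    using X that by (auto simp: min_weight_basis_iff_local)
  have Yloc: "w a \<le> w b" if "exchange_pair \<I> Y E (a, b)" for a b
    using Y that by (auto simp: min_weight_basis_iff_local)
  have optD: "exchange_pair \<I> X Y (e, e')"
    "\<And>a b. exchange_pair \<I> X Y (a, b) \<Longrightarrow> w a - w b \<le> ?m"
    using opt by (auto simp: optimal_exchange_pair_iff)
  note p = exchange_pairD[OF optD(1)]
  have "exchange_pair \<I> X E (e, e')"
    using p basis_subset_ground[OF Yb] by (auto simp: exchange_pair_def)
  from Xloc[OF this] have e: "e \<in> E\<^sub>0" and e': "e' \<notin> E\<^sub>0" and "?m \<le> c"
    using pos \<open>c \<ge> 0\<close> by (auto simp: penalised_def split: if_splits)
  show "e \<in> E\<^sub>0" "e' \<notin> E\<^sub>0" by fact+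
  have gain: "w a - w b \<le> ?m" if "exchange_pair \<I> X E (a, b)" for a b
  proof (cases "b \<in> Y")
    case True
    with that optD(2)[of a b] show ?thesis by (auto simp: exchange_pair_def)
  next
    case False
    let ?B = "insert b (X - {a})"
    note ab = exchange_pairD[OF that]
    have "b \<in> ?B - Y" using False by simp
    from strong_basis_exchange[OF ab(4) Yb this]
    obtain y where y: "y \<in> Y - ?B" "basis \<I> (insert y (?B - {b}))" "basis \<I> (insert b (Y - {y}))" .
    have wyb: "w y \<le> w b" using Yloc[of y b] y ab False by (auto simp: exchange_pair_def)
    show ?thesis
    \<comment> \<open>If \<open>y = a\<close>, then \<open>w a \<le> w b\<close> and the gain is not
      positive. Otherwise \<open>(a, y)\<close> is a pair with entering element in \<open>Y\<close>
      and at least the same gain.\<close>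
    proof (cases "y = a")
      case False
      have "?B - {b} = X - {a}" using ab by auto
      then have "exchange_pair \<I> X Y (a, y)" using y ab False by (auto simp: exchange_pair_def)
      from optD(2)[OF this] wyb show ?thesis by simp
    qed (use wyb pos in simp)
  qed
  let ?v = "penalised w E\<^sub>0 ?m"
  have Xm: "min_weight_basis \<I> ?v X"
    unfolding min_weight_basis_iff_local
  proof (intro conjI allI impI)
    fix a b assume "exchange_pair \<I> X E (a, b)"
    from Xloc[OF this] gain[OF this] \<open>?m \<le> c\<close> show "?v a \<le> ?v b"
      by (auto simp: penalised_def split: if_splits)
  qed (rule Xb)
  \<comment> \<open>For the multiplier \<open>?m\<close>, the elements \<open>e\<close> and
    \<open>e'\<close> have equal penalised weight.\<close>
  have "sum ?v (insert e' (X - {e})) = sum ?v X"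
    using p e e' basis_finite[OF Xb] by (simp add: sum_diff1 penalised_def)
  with Xm p(4) show "min_weight_basis \<I> ?v (insert e' (X - {e}))"
    by (simp add: min_weight_basis_iff)
qed

text \<open>The algorithm goes on exchanging after a minimum is reached. Comparison with
  \<open>Y\<close> alone shows that \<open>X\<close> is minimal; the next swap cannot lose weight
  optimality, because a negative largest gain would make \<open>X\<close> strictly lighter than
  \<open>Y\<close>.\<close>

lemma exchange_no_gain:
  assumes X: "basis \<I> X" and Y: "min_weight_basis \<I> w Y"
    and opt: "optimal_exchange_pair \<I> w X Y (e, e')" and "w e - w e' \<le> 0"
  shows "min_weight_basis \<I> w (insert e' (X - {e}))"
proof -
  have Yb: "basis \<I> Y" using Y by (simp add: min_weight_basis_iff)
  have optD: "exchange_pair \<I> X Y (e, e')"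
    "\<And>a b. exchange_pair \<I> X Y (a, b) \<Longrightarrow> w a - w b \<le> w e - w e'"
    using opt by (auto simp: optimal_exchange_pair_iff)
  have "w a \<le> w b" if "exchange_pair \<I> X Y (a, b)" for a b
    using optD(2)[OF that] assms(4) by simp
  from sum_basis_le[OF X Yb this] have Xm: "min_weight_basis \<I> w X"
    using X Y by (force simp: min_weight_basis_iff)
  have "w e' \<le> w e"
  proof (rule ccontr)
    assume "\<not> w e' \<le> w e"
    \<comment> \<open>all gains are at most \<open>- d < 0\<close>, so the weights on \<open>Y - X\<close> can be lowered by \<open>d\<close>\<close>
    define d where "d = w e' - w e"
    have "d > 0" using \<open>\<not> w e' \<le> w e\<close> by (simp add: d_def)
    let ?v = "\<lambda>x. if x \<in> Y - X then w x - d else w x"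
    have "sum ?v X \<le> sum ?v Y"
    proof (rule sum_basis_le[OF X Yb])
      show "?v a \<le> ?v b" if "exchange_pair \<I> X Y (a, b)" for a b
        using optD(2)[OF that] exchange_pairD[OF that] by (auto simp: d_def)
    qed
    moreover have "sum ?v X = sum w X" by (rule sum.cong) auto
    moreover have "sum ?v Y < sum w Y"
    proof (rule sum_strict_mono_ex1)
      show "\<exists>a\<in>Y. ?v a < w a" using exchange_pairD[OF optD(1)] \<open>d > 0\<close> by (intro bexI[of _ e']) auto
    qed (use basis_finite[OF Yb] \<open>d > 0\<close> in auto)
    moreover have "sum w Y \<le> sum w X" using Y X by (simp add: min_weight_basis_iff)
    ultimately show False by simp
  qed
  then have "sum w (insert e' (X - {e})) \<le> sum w X"
    using exchange_pairD[OF optD(1)] basis_finite[OF X] by (simp add: sum_diff1)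
  then show "min_weight_basis \<I> w (insert e' (X - {e}))"
    using Xm exchange_pairD(4)[OF optD(1)] by (force simp: min_weight_basis_iff)
qed

text \<open>The alternatives reflect two phases. While gains are positive, each exchange adds
  exactly one element outside \<open>E\<^sub>0\<close>. Afterwards exchanges have zero gain and need
  not change that number, so only minimality is kept.\<close>

lemma greedy_run_invariant:
  assumes B: "basis \<I> B" "B \<subseteq> E\<^sub>0" and start: "greedy_start \<I> w E\<^sub>0 X\<^sub>0 Y"
    and run: "greedy_run \<I> w Y X\<^sub>0 es X"
  shows "min_weight_basis \<I> w X \<or>
    card (X - E\<^sub>0) = length es \<and>
      (\<exists>c\<ge>0. min_weight_basis \<I> (penalised w E\<^sub>0 c) X)"
  using run
proof (induction rule: greedy_run.induct)
  case init
  have X0: "min_weight_basis (restriction \<I> E\<^sub>0) w X\<^sub>0" using start by (simp add: greedy_start_def)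
  from min_weight_basis_penalised_start[OF B X0]
  have "\<exists>c\<ge>0. min_weight_basis \<I> (penalised w E\<^sub>0 c) X\<^sub>0" by metis
  moreover have "X\<^sub>0 - E\<^sub>0 = {}" using X0 min_weight_basis_restriction_iff[OF B] by auto
  ultimately show ?case by (metis card.empty list.size(3))
next
  case (exchange es X e e')
  have Y: "min_weight_basis \<I> w Y" using start by (simp add: greedy_start_def)
  have X: "basis \<I> X" using exchange.IH by (auto simp: min_weight_basis_iff)
  have p: "exchange_pair \<I> X Y (e, e')" using exchange.hyps by (simp add: optimal_exchange_pair_iff)
  note p = exchange_pairD[OF p]
  show ?case
  proof (cases "w e - w e' \<le> 0")
    case True
    then show ?thesis using exchange_no_gain[OF X Y exchange.hyps(2)] by simp
  next
    case False
    \<comment> \<open>A positive gain rules out the first alternative for \<open>X\<close>, so the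
      second one supplies the count and the multiplier.\<close>
    have "\<not> min_weight_basis \<I> w X"
    proof
      assume "min_weight_basis \<I> w X"
      moreover have "exchange_pair \<I> X E (e, e')"
        using p Y basis_subset_ground[of Y] by (auto simp: exchange_pair_def min_weight_basis_iff)
      ultimately show False using False by (auto simp: min_weight_basis_iff_local)
    qed
    then obtain c where IH: "card (X - E\<^sub>0) = length es" and c: "c \<ge> 0"
      "min_weight_basis \<I> (penalised w E\<^sub>0 c) X" using exchange.IH by auto
    have pos: "w e - w e' > 0" using False by simp
    note step = penalised_exchange[OF c(2,1) Y exchange.hyps(2) pos]
    have eq: "insert e' (X - {e}) - E\<^sub>0 = insert e' (X - E\<^sub>0)" using step(1,2) by auto
    have "card (insert e' (X - {e}) - E\<^sub>0) = length (es @ [e'])"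
      unfolding eq using IH p basis_finite[OF X] by simp
    moreover have "\<exists>c\<ge>0. min_weight_basis \<I> (penalised w E\<^sub>0 c) (insert e' (X - {e}))"
      using step(3) pos by (intro exI[of _ "w e - w e'"]) simp
    ultimately show ?thesis by blast
  qed
qed

text \<open>Weak duality: \<open>X\<close> uses the allowed number of outside elements exactly, so
  its penalty is at least that of \<open>Z\<close>, and penalised minimality passes to
  \<open>w\<close>.\<close>

lemma greedy_run_weight_le:
  assumes "basis \<I> B" "B \<subseteq> E\<^sub>0" "greedy_start \<I> w E\<^sub>0 X\<^sub>0 Y"
    and "greedy_run \<I> w Y X\<^sub>0 es X" and Z: "basis \<I> Z" "card (Z - E\<^sub>0) \<le> length es"
  shows "sum w X \<le> sum w Z"
  using greedy_run_invariant[OF assms(1-4)]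
proof
  assume "min_weight_basis \<I> w X"
  then show ?thesis using Z by (simp add: min_weight_basis_iff)
next
  assume "card (X - E\<^sub>0) = length es \<and>
    (\<exists>c\<ge>0. min_weight_basis \<I> (penalised w E\<^sub>0 c) X)"
  then obtain c where c: "c \<ge> 0" "min_weight_basis \<I> (penalised w E\<^sub>0 c) X"
    and card: "card (X - E\<^sub>0) = length es" by auto
  then have "sum w X + c * real (length es) \<le> sum w Z + c * real (card (Z - E\<^sub>0))"
    using Z basis_finite by (auto simp: min_weight_basis_iff sum_penalised simp flip: card)
  moreover have "c * real (card (Z - E\<^sub>0)) \<le> c * real (length es)"
    using c Z(2) by (intro mult_left_mono) auto
  ultimately show ?thesis by simp
qed

text \<open>\<open>Y\<close> itself is an admissible competitor: \<open>X\<^sub>0\<close> lies in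
  \<open>E\<^sub>0\<close>, so \<open>Y\<close> has at most \<open>card (Y - X\<^sub>0)\<close>
  elements outside \<open>E\<^sub>0\<close>.\<close>

lemma complete_greedy_run_min:
  assumes B: "basis \<I> B" "B \<subseteq> E\<^sub>0" and start: "greedy_start \<I> w E\<^sub>0 X\<^sub>0 Y"
    and run: "greedy_run \<I> w Y X\<^sub>0 es X" and len: "length es = card (Y - X\<^sub>0)"
  shows "min_weight_basis \<I> w X"
proof -
  have Y: "min_weight_basis \<I> w Y" using start by (simp add: greedy_start_def)
  have X0: "basis \<I> X\<^sub>0" "X\<^sub>0 \<subseteq> E\<^sub>0"
    using start min_weight_basis_restriction_iff[OF B] by (auto simp: greedy_start_def)
  have Yb: "basis \<I> Y" using Y by (simp add: min_weight_basis_iff)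
  have "card (Y - E\<^sub>0) \<le> length es"
    unfolding len by (rule card_mono) (use X0 basis_finite[OF Yb] in auto)
  from greedy_run_weight_le[OF B start run Yb this] have "sum w X \<le> sum w Y" .
  with Y greedy_run_basis[OF run X0(1)] show ?thesis by (force simp: min_weight_basis_iff)
qed

lemma greedy_run_prefix:
  assumes "greedy_run \<I> w Y X\<^sub>0 es X" "i \<le> length es"
  shows "\<exists>X'. greedy_run \<I> w Y X\<^sub>0 (take i es) X'"
  using assms
proof (induction rule: greedy_run.induct)
  case (exchange es X e e')
  show ?case
  proof (cases "i \<le> length es")
    case False
    then have "take i (es @ [e']) = es @ [e']" using exchange.prems by simp
    then show ?thesis using greedy_run.exchange[OF exchange.hyps] by metis
  qed (use exchange.IH in simp)
qed (auto intro: greedy_run.init)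

end

section \<open>Output sets and feasible solutions\<close>

lemma output_sets_subset:
  assumes "output_sets E E\<^sub>0 es A" "set es \<subseteq> E" "i \<le> card (E - E\<^sub>0)"
  shows "A i \<subseteq> E - E\<^sub>0"
  using assms(3)
proof (induction i)
  case 0
  then show ?case using assms(1) by (simp add: output_sets_def)
next
  case (Suc i)
  then have "Suc i \<in> {1..card (E - E\<^sub>0)}" by simp
  with assms(1) have "if Suc i \<le> length es \<and> es ! i \<notin> E\<^sub>0 \<union> A i then A (Suc i) = insert (es ! i) (A i)
      else \<exists>e\<in>E - (E\<^sub>0 \<union> A i). A (Suc i) = insert e (A i)"
    unfolding output_sets_def by (metis diff_Suc_1)
  then show ?case using Suc assms(2) nth_mem[of i es] by (auto split: if_splits)
qed

text \<open>Merges both branches of \<open>output_sets\<close>: an output element that is passed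
  over already lies in \<open>E\<^sub>0\<close> or in an earlier set.\<close>

lemma output_sets_step:
  assumes "output_sets E E\<^sub>0 es A" "Suc i \<le> card (E - E\<^sub>0)"
  obtains e where "e \<notin> A i" "A (Suc i) = insert e (A i)"
    "i < length es \<Longrightarrow> es ! i \<in> E\<^sub>0 \<union> A (Suc i)"
proof -
  have "Suc i \<in> {1..card (E - E\<^sub>0)}" using assms(2) by simp
  with assms(1) have "if Suc i \<le> length es \<and> es ! i \<notin> E\<^sub>0 \<union> A i then A (Suc i) = insert (es ! i) (A i)
      else \<exists>e\<in>E - (E\<^sub>0 \<union> A i). A (Suc i) = insert e (A i)"
    unfolding output_sets_def by (metis diff_Suc_1)
  then show thesis using that by (auto split: if_splits)
qed

lemma output_sets_feasible:
  assumes "output_sets E E\<^sub>0 es A" "set es \<subseteq> E"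
  shows "imd_feasible E E\<^sub>0 A"
  unfolding imd_feasible_def
proof (intro conjI ballI)
  show "A 0 = {}" using assms(1) by (simp add: output_sets_def)
  fix i assume i: "i \<in> {1..card (E - E\<^sub>0)}"
  show "A i \<subseteq> E - E\<^sub>0" using output_sets_subset[OF assms] i by simp
  from i obtain j where j: "i = Suc j" by (cases i) auto
  from output_sets_step[OF assms(1)] i j obtain e where "e \<notin> A j" "A (Suc j) = insert e (A j)"
    by (metis atLeastAtMost_iff)
  then have "A i - A (i - 1) = {e}" using j by auto
  then show "card (A i - A (i - 1)) = 1" by simp
qed

text \<open>Guarantees that the basis reached after \<open>i\<close> exchanges is available at index
  \<open>i\<close>, even if output elements were passed over.\<close>

lemma set_take_subset_output_sets:
  assumes "output_sets E E\<^sub>0 es A" "i \<le> card (E - E\<^sub>0)"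
  shows "set (take i es) \<subseteq> E\<^sub>0 \<union> A i"
  using assms(2)
proof (induction i)
  case (Suc i)
  from output_sets_step[OF assms(1) Suc.prems] obtain e where
    e: "A (Suc i) = insert e (A i)" "i < length es \<Longrightarrow> es ! i \<in> E\<^sub>0 \<union> A (Suc i)" by metis
  show ?case
  proof (cases "i < length es")
    case True
    then show ?thesis using Suc e by (auto simp: take_Suc_conv_app_nth)
  next
    case False
    then have "take (Suc i) es = take i es" by simp
    then show ?thesis using Suc e by auto
  qed
qed simp

text \<open>Feasible families need not be nested, so elements may be lost on the way and only an
  upper bound holds.\<close>

lemma imd_feasible_card_le:
  assumes "imd_feasible E E\<^sub>0 A" "finite E" "i \<le> card (E - E\<^sub>0)"
  shows "finite (A i) \<and> card (A i) \<le> i"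
  using assms(3)
proof (induction i)
  case 0
  then show ?case using assms(1) by (simp add: imd_feasible_def)
next
  case (Suc i)
  have A: "A (Suc i) \<subseteq> E - E\<^sub>0" "card (A (Suc i) - A i) = 1"
    using assms(1) Suc.prems unfolding imd_feasible_def by force+
  have fin: "finite (A (Suc i))" using A assms(2) finite_subset by blast
  have "card (A (Suc i)) \<le> card (A i \<union> (A (Suc i) - A i))"
    by (rule card_mono) (use fin Suc in auto)
  also have "\<dots> \<le> card (A i) + card (A (Suc i) - A i)" by (rule card_Un_le)
  finally show ?case using A fin Suc by simp
qed

section \<open>Indexwise comparison with feasible solutions\<close>

context matroid
begin

lemma mwb_value_le:
  assumes "basis \<I> X" "X \<subseteq> E\<^sub>0 \<union> A"
  shows "mwb_value \<I> w E\<^sub>0 A \<le> sum w X"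
  unfolding mwb_value_def
  by (rule Min_le) (use assms finite_subset[OF _ finite_bases] in auto)

lemma mwb_value_attained:
  assumes "basis \<I> B" "B \<subseteq> E\<^sub>0"
  obtains Z where "basis \<I> Z" "Z \<subseteq> E\<^sub>0 \<union> A" "mwb_value \<I> w E\<^sub>0 A = sum w Z"
proof -
  let ?P = "{X. basis \<I> X \<and> X \<subseteq> E\<^sub>0 \<union> A}"
  have "finite (sum w ` ?P)" by (rule finite_imageI, rule finite_subset[OF _ finite_bases]) auto
  moreover have "sum w ` ?P \<noteq> {}" using assms by auto
  ultimately have "Min (sum w ` ?P) \<in> sum w ` ?P" by (rule Min_in)
  then show thesis using that by (auto simp: mwb_value_def)
qed

lemma mwb_value_output_le:
  assumes B: "basis \<I> B" "B \<subseteq> E\<^sub>0" and start: "greedy_start \<I> w E\<^sub>0 X\<^sub>0 Y"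
    and run: "greedy_run \<I> w Y X\<^sub>0 es X" and len: "length es = card (Y - X\<^sub>0)"
    and out: "output_sets E E\<^sub>0 es A" and feas: "imd_feasible E E\<^sub>0 A'"
    and i: "i \<le> card (E - E\<^sub>0)"
  shows "mwb_value \<I> w E\<^sub>0 (A i) \<le> mwb_value \<I> w E\<^sub>0 (A' i)"
proof -
  have X0: "basis \<I> X\<^sub>0" "X\<^sub>0 \<subseteq> E\<^sub>0"
    using start min_weight_basis_restriction_iff[OF B] by (auto simp: greedy_start_def)
  obtain Z where Z: "basis \<I> Z" "Z \<subseteq> E\<^sub>0 \<union> A' i" "mwb_value \<I> w E\<^sub>0 (A' i) = sum w Z"
    using mwb_value_attained[OF B] .
  have "\<exists>X'. greedy_run \<I> w Y X\<^sub>0 (take i es) X' \<and> sum w X' \<le> sum w Z"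
  proof (cases "i \<le> length es")
    case True
    with greedy_run_prefix[OF run] obtain X' where X': "greedy_run \<I> w Y X\<^sub>0 (take i es) X'" by blast
    have A': "finite (A' i)" "card (A' i) \<le> i"
      using imd_feasible_card_le[OF feas finite_ground i] by auto
    have "card (Z - E\<^sub>0) \<le> card (A' i)" by (rule card_mono) (use A' Z in auto)
    then have "card (Z - E\<^sub>0) \<le> length (take i es)" using A' True by simp
    from greedy_run_weight_le[OF B start X' Z(1) this] X' show ?thesis by blast
  next
    \<comment> \<open>Past the end of the output \<open>take i es\<close> is all of
      \<open>es\<close>, and the final basis is minimal in the whole matroid.\<close>
    case False
    then show ?thesis using run Z complete_greedy_run_min[OF B start run len]
      by (auto simp: min_weight_basis_iff)
  qed
  then obtain X' where X': "greedy_run \<I> w Y X\<^sub>0 (take i es) X'" "sum w X' \<le> sum w Z" by blast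
  have "X' \<subseteq> E\<^sub>0 \<union> A i"
    using greedy_run_set_subset(2)[OF X'(1)] set_take_subset_output_sets[OF out i] X0 by auto
  from mwb_value_le[OF greedy_run_basis[OF X'(1) X0(1)] this] X' Z show ?thesis by (metis order_trans)
qed

end

section \<open>Progress, a repetition-free run, and optimality\<close>

theorem corollary1:
  fixes E E\<^sub>0 :: "'a set" and \<I> :: "'a set set" and w :: "'a \<Rightarrow> real"
  assumes "matroid E \<I>"
    and "E\<^sub>0 \<subseteq> E"
    and "\<exists>B. basis \<I> B \<and> B \<subseteq> E\<^sub>0"
  shows
    \<comment> \<open>a run never gets stuck before \<open>card (Y - X\<^sub>0)\<close> exchanges\<close>
    "(\<forall>X\<^sub>0 Y es X. greedy_start \<I> w E\<^sub>0 X\<^sub>0 Y \<longrightarrow> greedy_run \<I> w Y X\<^sub>0 es X \<longrightarrow>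
        length es < card (Y - X\<^sub>0) \<longrightarrow> (\<exists>p. optimal_exchange_pair \<I> w X Y p)) \<and>
     (\<exists>X\<^sub>0 Y es X. greedy_start \<I> w E\<^sub>0 X\<^sub>0 Y \<and> greedy_run \<I> w Y X\<^sub>0 es X \<and>
        length es = card (Y - X\<^sub>0) \<and> distinct es \<and> set es \<subseteq> E - E\<^sub>0) \<and>
     (\<forall>X\<^sub>0 Y es X A. greedy_start \<I> w E\<^sub>0 X\<^sub>0 Y \<longrightarrow> greedy_run \<I> w Y X\<^sub>0 es X \<longrightarrow>
        length es = card (Y - X\<^sub>0) \<longrightarrow> output_sets E E\<^sub>0 es A \<longrightarrow> imd_optimal E \<I> w E\<^sub>0 A)"
proof -
  interpret matroid E \<I> by fact
  obtain B where B: "basis \<I> B" "B \<subseteq> E\<^sub>0" using assms(3) by blast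
  have start_bases: "basis \<I> X\<^sub>0" "X\<^sub>0 \<subseteq> E\<^sub>0" "basis \<I> Y" "finite Y" "Y \<subseteq> E"
    if "greedy_start \<I> w E\<^sub>0 X\<^sub>0 Y" for X\<^sub>0 Y
    using that min_weight_basis_restriction_iff[OF B] basis_finite basis_subset_ground
    by (auto simp: greedy_start_def min_weight_basis_iff)
  show ?thesis
  proof (intro conjI allI impI)
    fix X\<^sub>0 Y es X
    assume start: "greedy_start \<I> w E\<^sub>0 X\<^sub>0 Y" and run: "greedy_run \<I> w Y X\<^sub>0 es X"
      and len: "length es < card (Y - X\<^sub>0)"
    note bases = start_bases[OF start]
    have "Y \<noteq> X" using greedy_run_card_diff[OF run bases(4)] len by auto
    with optimal_exchange_pair_exists[OF greedy_run_basis[OF run bases(1)] bases(3)]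
    show "\<exists>p. optimal_exchange_pair \<I> w X Y p" by metis
  next
    from compatible_greedy_start_exists[OF B] obtain X\<^sub>0 Y where
      start: "greedy_start \<I> w E\<^sub>0 X\<^sub>0 Y" and sub: "Y \<inter> E\<^sub>0 \<subseteq> X\<^sub>0" .
    note bases = start_bases[OF start]
    have "min_weight_basis \<I> w Y" using start by (simp add: greedy_start_def)
    from clean_greedy_run_exists[OF bases(1) this order_refl] obtain es X where
      "greedy_run \<I> w Y X\<^sub>0 es X" "length es = card (Y - X\<^sub>0)" "distinct es" "set es \<subseteq> Y - X\<^sub>0"
      by blast
    moreover have "Y - X\<^sub>0 \<subseteq> E - E\<^sub>0" using sub bases by auto
    ultimately show "\<exists>X\<^sub>0 Y es X. greedy_start \<I> w E\<^sub>0 X\<^sub>0 Y \<and> greedy_run \<I> w Y X\<^sub>0 es X \<and>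
        length es = card (Y - X\<^sub>0) \<and> distinct es \<and> set es \<subseteq> E - E\<^sub>0"
      using start by blast
  next
    fix X\<^sub>0 Y es X A
    assume start: "greedy_start \<I> w E\<^sub>0 X\<^sub>0 Y" and run: "greedy_run \<I> w Y X\<^sub>0 es X"
      and len: "length es = card (Y - X\<^sub>0)" and out: "output_sets E E\<^sub>0 es A"
    have "set es \<subseteq> E" using greedy_run_set_subset(1)[OF run] start_bases[OF start] by auto
    then have "imd_feasible E E\<^sub>0 A" by (rule output_sets_feasible[OF out])
    moreover have "imd_objective E \<I> w E\<^sub>0 A \<le> imd_objective E \<I> w E\<^sub>0 A'"
      if "imd_feasible E E\<^sub>0 A'" for A'
      \<comment> \<open>The greedy family is no worse at every single index, so the sums compare
        term by term.\<close>
      unfolding imd_objective_def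
      by (rule sum_mono) (use mwb_value_output_le[OF B start run len out that] in simp)
    ultimately show "imd_optimal E \<I> w E\<^sub>0 A"
      by (simp add: imd_optimal_def is_arg_min_linorder)
  qed
qed

end
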